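(* Let $t$ be a fixed positive integer. If $G$ is a finite soluble group and $H$ is a subgroup of $G$ that is $\mathrm{K}$-$\mathbb{P}_{t}$-subnormal in $G$, then $H$ is $\mathfrak{U}_{t}$-subnormal in $G$.
   Context: All groups are finite, and $t$ is a fixed natural number ($t\ge 1$). A subgroup $H$ of a group $G$ is called $\mathrm{K}$-$\mathbb{P}_{t}$-subnormal in $G$ if there exists a chain of subgroups $H=H_{0}\leq H_{1}\leq\cdots\leq H_{n-1}\leq H_{n}=G$ such that for every $i=1,\ldots,n$ either $H_{i-1}\unlhd H_{i}$, or $|H_{i}:H_{i-1}|$ is a prime $p$ such that $p-1$ is not divisible by the $(t+1)$th power of any prime. $\mathfrak{U}_{t}$ is the class of all supersoluble groups whose exponent is not divisible by the $(t+1)$th power of any prime; it is a hereditary formation (a class closed under subgroups, quotients, and such that $G/N_1,G/N_2\in\mathfrak{U}_t$ with $N_1,N_2\unlhd G$ implies $G/(N_1\cap N_2)\in\mathfrak{U}_t$). For a non-empty formation $\mathfrak{F}$, $G^{\mathfrak{F}}$ denotes the least normal subgroup of $G$ with $G/G^{\mathfrak{F}}\in\mathfrak{F}$. A subgroup $H$ of $G$ is $\mathfrak{F}$-subnormal in $G$ if either $H=G$ or there is a chain of subgroups $H=H_{0}\leq H_{1}\leq\cdots\leq H_{n}=G$ such that $H_{i}^{\mathfrak{F}}\leq H_{i-1}$ for every $i=1,\ldots,n$. *)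

theory Defs
  imports
    "HOL-Algebra.Elementary_Groups"
    "HOL-Algebra.Solvable_Groups"
    "HOL-Computational_Algebra.Primes"
begin

definition power_free :: "nat \<Rightarrow> nat \<Rightarrow> bool" where
  "power_free k m \<longleftrightarrow> \<not> (\<exists>q. prime q \<and> q ^ k dvd m)"

definition subgroup_index :: "('a, 'b) monoid_scheme \<Rightarrow> 'a set \<Rightarrow> nat" where
  "subgroup_index G H = card (rcosets\<^bsub>G\<^esub> H)"

definition group_exponent :: "('a, 'b) monoid_scheme \<Rightarrow> nat" where
  "group_exponent G = (LEAST e. e > 0 \<and> (\<forall>x\<in>carrier G. x [^]\<^bsub>G\<^esub> e = \<one>\<^bsub>G\<^esub>))"

definition supersoluble :: "('a, 'b) monoid_scheme \<Rightarrow> bool" where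
  "supersoluble G \<longleftrightarrow>
     (\<exists>(n::nat) N. N 0 = {\<one>\<^bsub>G\<^esub>} \<and> N n = carrier G \<and> (\<forall>i\<le>n. N i \<lhd> G) \<and>
        (\<forall>i<n. N i \<subseteq> N (Suc i) \<and> cyclic_group ((G\<lparr>carrier := N (Suc i)\<rparr>) Mod N i)))"

definition KP_subnormal :: "nat \<Rightarrow> 'a set \<Rightarrow> ('a, 'b) monoid_scheme \<Rightarrow> bool" where
  "KP_subnormal t H G \<longleftrightarrow>
     (\<exists>(n::nat) C. C 0 = H \<and> C n = carrier G \<and> (\<forall>i\<le>n. subgroup (C i) G) \<and>
        (\<forall>i<n. C i \<subseteq> C (Suc i) \<and>
           (C i \<lhd> G\<lparr>carrier := C (Suc i)\<rparr> \<or>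
            (\<exists>p. prime p \<and> subgroup_index (G\<lparr>carrier := C (Suc i)\<rparr>) (C i) = p \<and>
                 power_free (t + 1) (p - 1)))))"

definition U_class :: "nat \<Rightarrow> ('a, 'b) monoid_scheme \<Rightarrow> bool" where
  "U_class t G \<longleftrightarrow>
     group G \<and> finite (carrier G) \<and> supersoluble G \<and> power_free (t + 1) (group_exponent G)"

text \<open>A class of groups is a predicate. It is needed only on quotients of subgroups of a group
  over \<open>'a\<close>, whose elements are cosets, hence the type \<open>'a set monoid \<Rightarrow> bool\<close>.
  The least subgroup below is guaranteed to exist only when the class is a non-empty formation
  and the group is finite.\<close>

definition residual :: "('a set monoid \<Rightarrow> bool) \<Rightarrow> ('a, 'b) monoid_scheme \<Rightarrow> 'a set" where
  "residual F G = (LEAST N. N \<lhd> G \<and> F (G Mod N))"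

definition F_subnormal ::
  "('a set monoid \<Rightarrow> bool) \<Rightarrow> 'a set \<Rightarrow> ('a, 'b) monoid_scheme \<Rightarrow> bool" where
  "F_subnormal F H G \<longleftrightarrow>
     H = carrier G \<or>
     (\<exists>(n::nat) C. C 0 = H \<and> C n = carrier G \<and> (\<forall>i\<le>n. subgroup (C i) G) \<and>
        (\<forall>i<n. C i \<subseteq> C (Suc i) \<and> residual F (G\<lparr>carrier := C (Suc i)\<rparr>) \<subseteq> C i))"

end

theory Submission
  imports Defs "HOL-Algebra.Zassenhaus" "HOL-Number_Theory.Residues"
begin

text \<open>
  Write U for the class \<open>U_class t\<close>. It suffices to replace every link \<open>A \<le> B\<close> of the given chain
  by a chain of links in each of which the U-residual of the upper group lies in the lower one. For this it is
  enough to find a normal subgroup of the upper group that is contained in the lower one and has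
  its quotient in U: U is closed under subdirect products, so the normal subgroups with
  quotient in U are closed under intersection and the residual is contained in each of them
  (\<open>residual_U_class_subset\<close>).

  If \<open>A\<close> is normal in the soluble group \<open>B\<close>, a composition series from \<open>A\<close> to \<open>B\<close> has factors of
  prime order, and these belong to U because \<open>t \<ge> 1\<close> (\<open>U_subnormal_steps_normal\<close>).

  If \<open>A\<close> has prime index \<open>p\<close> in \<open>B\<close>, let \<open>N\<close> be the largest normal subgroup of \<open>B\<close> inside \<open>A\<close>. The
  quotient \<open>B/N\<close> is a soluble primitive group of degree \<open>p\<close>. Hence it has a normal subgroup \<open>P\<close> of
  order \<open>p\<close> that is its own centralizer (\<open>U_class_core_free\<close>). Conjugation embeds the quotient by
  \<open>P\<close> into the automorphism group of \<open>P\<close>, which is cyclic of order \<open>p - 1\<close>. So \<open>B/N\<close> is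
  supersoluble and its exponent divides \<open>p(p - 1)\<close>, a number that inherits from \<open>p - 1\<close> the
  property of not being divisible by the \<open>(t + 1)\<close>-th power of a prime
  (\<open>U_class_self_centralizing\<close>).
\<close>

section \<open>Power-free numbers and exponents\<close>

lemma power_free_dvd:
  assumes "power_free k n" "m dvd n"
  shows "power_free k m"
  using assms unfolding power_free_def by (meson dvd_trans)

lemma power_free_lcm:
  assumes "power_free k m" "power_free k n" "m > 0" "n > 0"
  shows "power_free k (lcm m n)"
  unfolding power_free_def
proof
  assume "\<exists>q. prime q \<and> q ^ k dvd lcm m n"
  then obtain q where q: "prime q" "q ^ k dvd lcm m n" by blast
  have "k \<le> multiplicity q (lcm m n)"
    using q assms(3,4) by (intro multiplicity_geI) (auto simp: lcm_eq_0_iff)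
  also have "\<dots> = max (multiplicity q m) (multiplicity q n)"
    using assms(3,4) q(1) by (simp add: multiplicity_lcm)
  finally have "q ^ k dvd m \<or> q ^ k dvd n"
    using multiplicity_dvd' by (auto simp: le_max_iff_disj)
  with assms(1,2) q(1) show False unfolding power_free_def by blast
qed

lemma power_free_prime:
  assumes "prime (q :: nat)" "k \<ge> 2"
  shows "power_free k q"
  unfolding power_free_def
proof
  assume "\<exists>r. prime r \<and> r ^ k dvd q"
  then obtain r where r: "prime r" "r ^ k dvd q" by blast
  have "r ^ 2 dvd r ^ k" using assms(2) by (rule le_imp_power_dvd)
  then have rr: "r * r dvd q" using r(2) by (metis dvd_trans power2_eq_square)
  then have "r = q" using r(1) assms(1) primes_dvd_imp_eq by (metis dvd_mult_left)
  then show False using rr assms(1) by (auto simp: prime_gt_0_nat)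
qed

text \<open>The number \<open>p * (p - 1)\<close> is the order of the holomorph of a group of order \<open>p\<close>, which bounds
  the exponent in the non-normal links of the chain. A high power of a prime \<open>q\<close> dividing it
  would have to divide \<open>p - 1\<close>, unless \<open>q = p\<close>, and \<open>p\<close> divides it exactly once.\<close>

lemma power_free_prime_times_pred:
  assumes "prime (p :: nat)" "k \<ge> 2" "power_free k (p - 1)"
  shows "power_free k (p * (p - 1))"
  unfolding power_free_def
proof
  assume "\<exists>q. prime q \<and> q ^ k dvd p * (p - 1)"
  then obtain q where q: "prime q" "q ^ k dvd p * (p - 1)" by blast
  show False
  proof (cases "q = p")
    case True
    have "p ^ 2 dvd p ^ k" using assms(2) by (rule le_imp_power_dvd)
    then have "p * p dvd p * (p - 1)" using q True by (metis dvd_trans power2_eq_square)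
    then have "p dvd p - 1" using prime_gt_0_nat[OF assms(1)] by simp
    moreover have "0 < p - 1" "p - 1 < p" using prime_gt_1_nat[OF assms(1)] by auto
    ultimately show False using nat_dvd_not_less by blast
  next
    case False
    then have "coprime (q ^ k) p"
      using q(1) assms(1) by (simp add: primes_coprime)
    then have "q ^ k dvd p - 1" using q(2) by (simp add: coprime_dvd_mult_right_iff)
    then show False using q(1) assms(3) unfolding power_free_def by blast
  qed
qed

text \<open>The exponent is a least positive number by definition; it acquires its usual meaning as soon
  as some positive power annihilates the group, and a division with remainder makes it divide
  every such power.\<close>

lemma (in group) group_exponent_properties:
  assumes "n > 0" "\<And>x. x \<in> carrier G \<Longrightarrow> x [^] n = \<one>"
  shows "group_exponent G > 0"
    and "\<And>x. x \<in> carrier G \<Longrightarrow> x [^] group_exponent G = \<one>"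
    and "group_exponent G dvd n"
proof -
  let ?P = "\<lambda>e. e > 0 \<and> (\<forall>x\<in>carrier G. x [^] e = \<one>)"
  have P: "?P (group_exponent G)"
    unfolding group_exponent_def by (rule LeastI[of ?P n]) (use assms in auto)
  then show pos: "group_exponent G > 0"
    and killed: "\<And>x. x \<in> carrier G \<Longrightarrow> x [^] group_exponent G = \<one>" by auto
  show "group_exponent G dvd n"
  proof (rule ccontr)
    assume "\<not> group_exponent G dvd n"
    then have r: "n mod group_exponent G > 0" by (simp add: mod_greater_zero_iff_not_dvd)
    have "x [^] (n mod group_exponent G) = \<one>" if x: "x \<in> carrier G" for x
    proof -
      have "\<one> = x [^] (group_exponent G * (n div group_exponent G) + n mod group_exponent G)"
        using assms(2)[OF x] by simp
      also have "\<dots> = (x [^] group_exponent G) [^] (n div group_exponent G)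
                       \<otimes> x [^] (n mod group_exponent G)"
        using x by (simp only: nat_pow_mult nat_pow_pow nat_pow_closed)
      also have "\<dots> = x [^] (n mod group_exponent G)"
        using x killed[OF x] by simp
      finally show ?thesis by simp
    qed
    then have "?P (n mod group_exponent G)" using r by blast
    then have "group_exponent G \<le> n mod group_exponent G"
      unfolding group_exponent_def by (rule Least_le)
    moreover have "n mod group_exponent G < group_exponent G" using pos by simp
    ultimately show False by simp
  qed
qed

text \<open>Power-freeness passes to divisors, so any power-free multiple of the exponent certifies
  membership.\<close>

lemma U_classI:
  assumes "group G" "finite (carrier G)" "supersoluble G"
    and "n > 0" "\<And>x. x \<in> carrier G \<Longrightarrow> x [^]\<^bsub>G\<^esub> n = \<one>\<^bsub>G\<^esub>" "power_free (t + 1) n"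
  shows "U_class t G"
  using assms group.group_exponent_properties(3)[OF assms(1,4,5)] power_free_dvd
  unfolding U_class_def by blast

lemma (in group) U_class_exponentE:
  assumes "U_class t G"
  shows "group_exponent G > 0"
    and "\<And>x. x \<in> carrier G \<Longrightarrow> x [^] group_exponent G = \<one>"
    and "power_free (t + 1) (group_exponent G)"
proof -
  have fin: "finite (carrier G)" and pf: "power_free (t + 1) (group_exponent G)"
    using assms unfolding U_class_def by auto
  have "order G > 0" using fin order_gt_0_iff_finite by blast
  with group_exponent_properties[of "order G"] pow_order_eq_1 pf
  show "group_exponent G > 0" "\<And>x. x \<in> carrier G \<Longrightarrow> x [^] group_exponent G = \<one>"
    "power_free (t + 1) (group_exponent G)" by blast+
qed

section \<open>Cyclic groups\<close>

lemma (in group) cyclic_subgroup: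
  assumes cyc: "cyclic_group G" and H: "subgroup H G"
  shows "cyclic_group (G\<lparr>carrier := H\<rparr>)"
proof -
  interpret H: group "G\<lparr>carrier := H\<rparr>" using H by (rule subgroup_imp_group)
  obtain x where x: "x \<in> carrier G" and gen: "carrier G = range (\<lambda>n::int. x [^] n)"
    using cyc cyclic_group by blast
  have zpow: "y [^]\<^bsub>G\<lparr>carrier := H\<rparr>\<^esub> n = y [^] n" if "y \<in> H" for y and n :: int
    using int_pow_consistent[OF H that] by simp
  have Hpow: "y [^] n \<in> H" if "y \<in> H" for y and n :: int
    using H.int_pow_closed[of y n] zpow[OF that] that by simp
  define P where "P d \<longleftrightarrow> d > 0 \<and> x [^] (int d) \<in> H" for d :: nat
  \<comment> \<open>If no positive power of \<open>x\<close> lies in \<open>H\<close>, then \<open>d = 0\<close> will do, as \<open>H\<close> is trivial.\<close>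
  define d where "d = (if \<exists>d. P d then LEAST d. P d else 0)"
  have dH: "x [^] (int d) \<in> H"
  proof (cases "\<exists>d. P d")
    case True
    then show ?thesis using LeastI_ex[of P] unfolding d_def P_def by simp
  next
    case False
    then have "d = 0" unfolding d_def by (rule if_not_P)
    then show ?thesis using subgroup.one_closed[OF H] by simp
  qed
  have dvd: "int d dvd n" if n: "x [^] n \<in> H" for n :: int
  proof (cases "\<exists>d. P d")
    case True
    then have d: "d = (LEAST d. P d)" unfolding d_def by (rule if_P)
    have Pd: "P d" unfolding d using True by (rule LeastI_ex)
    have eq: "x [^] (n mod int d) = x [^] n \<otimes> (x [^] int d) [^] (- (n div int d))"
      using x by (simp add: int_pow_pow minus_mult_div_eq_mod flip: int_pow_mult)
    have "x [^] (n mod int d) \<in> H"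
      unfolding eq by (intro subgroup.m_closed[OF H] n Hpow dH)
    then have "x [^] int (nat (n mod int d)) \<in> H" using Pd by (simp add: P_def)
    moreover have "nat (n mod int d) < d"
      using Pd by (simp add: P_def nat_less_iff)
    then have "\<not> P (nat (n mod int d))"
      unfolding d by (rule not_less_Least)
    ultimately have "nat (n mod int d) = 0" unfolding P_def by (metis gr0I)
    moreover have "n mod int d \<ge> 0" using Pd by (simp add: P_def)
    ultimately show ?thesis by (simp add: dvd_eq_mod_eq_0)
  next
    case False
    have "x [^] \<bar>n\<bar> \<in> H"
      using n subgroup.m_inv_closed[OF H n] x by (auto simp: abs_if int_pow_neg)
    then have "x [^] int (nat \<bar>n\<bar>) \<in> H" by simp
    then have "nat \<bar>n\<bar> = 0" using False unfolding P_def by (metis gr0I)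
    then show ?thesis by simp
  qed
  have "carrier (G\<lparr>carrier := H\<rparr>) = range (\<lambda>n::int. (x [^] int d) [^]\<^bsub>G\<lparr>carrier := H\<rparr>\<^esub> n)"
    (is "_ = ?R")
  proof
    show "?R \<subseteq> carrier (G\<lparr>carrier := H\<rparr>)" using Hpow[OF dH] by (auto simp: zpow[OF dH])
    show "carrier (G\<lparr>carrier := H\<rparr>) \<subseteq> ?R"
    proof
      fix y assume "y \<in> carrier (G\<lparr>carrier := H\<rparr>)"
      then have y: "y \<in> H" by simp
      then obtain n :: int where n: "y = x [^] n"
        using gen subgroup.mem_carrier[OF H] by blast
      obtain m where "n = int d * m" using dvd[of n] y n by blast
      then show "y \<in> ?R" using x n by (auto simp: zpow[OF dH] int_pow_pow)
    qed
  qed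
  then show ?thesis using H.cyclic_group dH by auto
qed

text \<open>A first isomorphism theorem for cyclicity, in which the homomorphism need not be onto because
  its image is again cyclic. All cyclic factors below are obtained this way.\<close>

lemma (in group_hom) cyclic_factor_kernel:
  assumes "cyclic_group H"
  shows "cyclic_group (G Mod kernel G H h)"
proof -
  let ?I = "H\<lparr>carrier := h ` carrier G\<rparr>"
  have I: "subgroup (h ` carrier G) H" using G.subgroup_self subgroup_img_is_subgroup by blast
  interpret I: group ?I using I by (rule H.subgroup_imp_group)
  interpret r: group_hom G ?I h
    by unfold_locales (auto simp: hom_def)
  have "G Mod kernel G ?I h \<cong> ?I" by (rule r.FactGroup_iso) simp
  moreover have "kernel G ?I h = kernel G H h" by (simp add: kernel_def)
  moreover have "group (G Mod kernel G H h)" using normal.factorgroup_is_group normal_kernel by blast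
  ultimately show ?thesis
    using isomorphic_group_cyclicity H.cyclic_subgroup[OF assms I] I.group_axioms by metis
qed

lemma (in group) cyclic_Mod_one:
  assumes "cyclic_group G"
  shows "cyclic_group (G Mod {\<one>})"
proof -
  have "group_hom G G (\<lambda>x. x)" by unfold_locales (simp add: hom_def)
  moreover have "kernel G G (\<lambda>x. x) = {\<one>}" by (auto simp: kernel_def)
  ultimately show ?thesis using group_hom.cyclic_factor_kernel assms by metis
qed

lemma (in group) prime_order_subgroup_powers:
  assumes P: "subgroup P G" and card: "card P = p" "prime p"
    and g: "g \<in> P" "g \<noteq> \<one>"
  shows "ord g = p" and "P = (\<lambda>i::int. g [^] i) ` {0..<int p}"
proof -
  interpret P: group "G\<lparr>carrier := P\<rparr>" using P by (rule subgroup_imp_group)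
  have gG: "g \<in> carrier G" using P g(1) by (rule subgroup.mem_carrier)
  have "g [^] p = \<one>"
    using P.pow_order_eq_1[of g] g(1) card nat_pow_consistent[of g p P] by (simp add: order_def)
  then have "ord g dvd p" using gG pow_eq_id by blast
  moreover have "ord g \<noteq> 1" using gG g(2) ord_eq_1 by blast
  ultimately show ord: "ord g = p" using card(2) unfolding prime_nat_iff by blast
  have finP: "finite P" using card by (metis card.infinite not_prime_0)
  have inj: "inj_on (\<lambda>i::int. g [^] i) {0..<int p}"
  proof (rule inj_onI)
    fix i j :: int
    assume ij: "i \<in> {0..<int p}" "j \<in> {0..<int p}" and eq: "g [^] i = g [^] j"
    then have "int p dvd j - i" using int_pow_eq[OF gG] ord by simp
    then have "i mod int p = j mod int p" by (simp add: mod_eq_dvd_iff dvd_diff_commute)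
    then show "i = j" using ij by simp
  qed
  have "g [^] i \<in> P" for i :: int
    using P.int_pow_closed[of g i] int_pow_consistent[OF P g(1), of i] g(1) by simp
  then have "(\<lambda>i::int. g [^] i) ` {0..<int p} = P"
    using finP card(1) card_image[OF inj] by (intro card_subset_eq) auto
  then show "P = (\<lambda>i::int. g [^] i) ` {0..<int p}" by simp
qed

lemma (in group) cyclic_prime_order_subgroup:
  assumes P: "subgroup P G" and card: "prime (card P)"
  shows "cyclic_group (G\<lparr>carrier := P\<rparr>)"
proof -
  interpret P: group "G\<lparr>carrier := P\<rparr>" using P by (rule subgroup_imp_group)
  have "P \<noteq> {\<one>}" using card by auto
  then obtain g where g: "g \<in> P" "g \<noteq> \<one>" using subgroup.one_closed[OF P] by blast
  have zpow: "g [^]\<^bsub>G\<lparr>carrier := P\<rparr>\<^esub> n = g [^] n" for n :: int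
    using int_pow_consistent[OF P g(1)] by simp
  have "P \<subseteq> range (\<lambda>n::int. g [^]\<^bsub>G\<lparr>carrier := P\<rparr>\<^esub> n)"
    using prime_order_subgroup_powers(2)[OF P refl card g] unfolding zpow by blast
  moreover have "range (\<lambda>n::int. g [^]\<^bsub>G\<lparr>carrier := P\<rparr>\<^esub> n) \<subseteq> P"
    using P.int_pow_closed[of g] g(1) by auto
  ultimately show ?thesis using P.cyclic_group g(1) by auto
qed

section \<open>Supersoluble groups as subdirect products\<close>

text \<open>One link of the normal series in the definition of supersolubility. The series itself then
  becomes a reflexive transitive closure, so that series can be concatenated without
  reindexing.\<close>

definition cyclic_step :: "('a, 'b) monoid_scheme \<Rightarrow> 'a set \<Rightarrow> 'a set \<Rightarrow> bool" where
  "cyclic_step G A B \<longleftrightarrow>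
     A \<lhd> G \<and> B \<lhd> G \<and> A \<subseteq> B \<and> cyclic_group ((G\<lparr>carrier := B\<rparr>) Mod A)"

lemma (in group) supersoluble_iff_cyclic_steps:
  "supersoluble G \<longleftrightarrow> (cyclic_step G)\<^sup>*\<^sup>* {\<one>} (carrier G)"
proof
  assume "supersoluble G"
  then obtain n N where "N 0 = {\<one>}" "N n = carrier G" "\<forall>i\<le>n. N i \<lhd> G"
    "\<forall>i<n. N i \<subseteq> N (Suc i) \<and> cyclic_group ((G\<lparr>carrier := N (Suc i)\<rparr>) Mod N i)"
    unfolding supersoluble_def by blast
  then have "(cyclic_step G ^^ n) {\<one>} (carrier G)"
    unfolding relpowp_fun_conv cyclic_step_def by (auto intro!: exI[of _ N])
  then show "(cyclic_step G)\<^sup>*\<^sup>* {\<one>} (carrier G)" by (rule relpowp_imp_rtranclp)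
next
  assume "(cyclic_step G)\<^sup>*\<^sup>* {\<one>} (carrier G)"
  then obtain n N where N: "N 0 = {\<one>}" "N n = carrier G"
    and step: "\<forall>i<n. cyclic_step G (N i) (N (Suc i))"
    unfolding rtranclp_power relpowp_fun_conv by blast
  have "N i \<lhd> G" if "i \<le> n" for i
  proof (cases i)
    case 0
    then show ?thesis using N one_is_normal by simp
  next
    case (Suc j)
    then show ?thesis using step that unfolding cyclic_step_def by auto
  qed
  then show "supersoluble G"
    using N step unfolding supersoluble_def cyclic_step_def by blast
qed

lemma (in group_hom) normal_vimage_Int:
  assumes "A \<lhd> H" "N \<lhd> G"
  shows "h -` A \<inter> N \<lhd> G"
proof -
  interpret A: normal A H by fact
  interpret N: normal N G by fact
  show ?thesis
  proof (rule G.normal_invI)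
    have "\<one> \<in> h -` A \<inter> N" using A.one_closed N.one_closed by simp
    then have "h -` A \<inter> N \<noteq> {}" by blast
    then show "subgroup (h -` A \<inter> N) G"
      by (intro G.subgroupI) (use A.subgroup_axioms N.subgroup_axioms in \<open>auto simp: subgroup.m_closed subgroup.m_inv_closed\<close>)
    show "x \<otimes> y \<otimes> inv x \<in> h -` A \<inter> N" if "x \<in> carrier G" "y \<in> h -` A \<inter> N" for x y
      using that A.inv_op_closed2[of "h x" "h y"] N.inv_op_closed2[of x y] by auto
  qed
qed

text \<open>Links pull back along homomorphisms, and may at the same time be cut down to a normal subgroup
  \<open>N\<close>. With \<open>N\<close> the whole group this refines the part of \<open>G\<close> above a kernel, with \<open>N\<close> another kernel
  it refines the part below.\<close>

lemma (in group_hom) cyclic_step_vimage_Int: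
  assumes "cyclic_step H A B" "N \<lhd> G"
  shows "cyclic_step G (h -` A \<inter> N) (h -` B \<inter> N)"
proof -
  have A: "A \<lhd> H" and B: "B \<lhd> H" and sub: "A \<subseteq> B"
    and cyc: "cyclic_group ((H\<lparr>carrier := B\<rparr>) Mod A)"
    using assms(1) unfolding cyclic_step_def by auto
  let ?B = "h -` B \<inter> N"
  have nA: "h -` A \<inter> N \<lhd> G" and nB: "?B \<lhd> G"
    using A B assms(2) by (auto intro: normal_vimage_Int)
  have sB: "subgroup B H" using B by (rule normal_imp_subgroup)
  have snB: "subgroup ?B G" using nB by (rule normal_imp_subgroup)
  interpret AB: normal A "H\<lparr>carrier := B\<rparr>"
    using H.normal_restrict_supergroup[OF sB A sub] .
  interpret B': group "G\<lparr>carrier := ?B\<rparr>" using snB by (rule G.subgroup_imp_group)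
  interpret Q: group "(H\<lparr>carrier := B\<rparr>) Mod A" by (rule AB.factorgroup_is_group)
  have "h \<in> hom (G\<lparr>carrier := ?B\<rparr>) (H\<lparr>carrier := B\<rparr>)"
    using subgroup.mem_carrier[OF snB] by (auto simp: hom_def)
  then have "(\<lambda>x. A #>\<^bsub>H\<lparr>carrier := B\<rparr>\<^esub> x) \<circ> h
             \<in> hom (G\<lparr>carrier := ?B\<rparr>) ((H\<lparr>carrier := B\<rparr>) Mod A)"
    using AB.r_coset_hom_Mod by (rule Group.hom_compose)
  then interpret f: group_hom "G\<lparr>carrier := ?B\<rparr>" "(H\<lparr>carrier := B\<rparr>) Mod A"
    "(\<lambda>x. A #>\<^bsub>H\<lparr>carrier := B\<rparr>\<^esub> x) \<circ> h"
    by (intro group_hom.intro group_hom_axioms.intro B'.group_axioms Q.group_axioms)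
  have "kernel (G\<lparr>carrier := ?B\<rparr>) ((H\<lparr>carrier := B\<rparr>) Mod A) ((\<lambda>x. A #>\<^bsub>H\<lparr>carrier := B\<rparr>\<^esub> x) \<circ> h)
        = h -` A \<inter> N" (is "?K = _")
  proof
    show "?K \<subseteq> h -` A \<inter> N"
      using AB.is_group AB.rcos_self AB.subgroup_axioms by (auto simp: kernel_def)
    show "h -` A \<inter> N \<subseteq> ?K"
      using sub AB.rcos_const[OF AB.is_group] by (auto simp: kernel_def)
  qed
  then have "cyclic_group ((G\<lparr>carrier := ?B\<rparr>) Mod (h -` A \<inter> N))"
    using f.cyclic_factor_kernel[OF cyc] by simp
  then show ?thesis using nA nB sub unfolding cyclic_step_def by auto
qed

lemma (in group_hom) cyclic_steps_vimage_Int: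
  assumes "(cyclic_step H)\<^sup>*\<^sup>* A B" "N \<lhd> G"
  shows "(cyclic_step G)\<^sup>*\<^sup>* (h -` A \<inter> N) (h -` B \<inter> N)"
  using assms(1)
proof induction
  case (step B C)
  then show ?case
    using cyclic_step_vimage_Int[OF _ assms(2)] by (meson rtranclp.rtrancl_into_rtrancl)
qed simp

text \<open>A series of \<open>K\<close>, pulled back and cut down to the kernel of \<open>f\<close>, climbs from the trivial subgroup
  to that kernel; a series of \<open>H\<close>, pulled back, continues from there to \<open>G\<close>.\<close>

lemma supersoluble_subdirect:
  assumes "group_hom G H f" "group_hom G K g"
    and ker: "kernel G H f \<inter> kernel G K g = {\<one>\<^bsub>G\<^esub>}"
    and ss: "supersoluble H" "supersoluble K"
  shows "supersoluble G"
proof -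
  interpret f: group_hom G H f by fact
  interpret g: group_hom G K g by fact
  let ?N = "kernel G H f"
  have "(cyclic_step G)\<^sup>*\<^sup>* (g -` {\<one>\<^bsub>K\<^esub>} \<inter> ?N) (g -` carrier K \<inter> ?N)"
    using ss(2) g.H.supersoluble_iff_cyclic_steps
    by (intro g.cyclic_steps_vimage_Int f.normal_kernel) blast
  moreover have "g -` {\<one>\<^bsub>K\<^esub>} \<inter> ?N = {\<one>\<^bsub>G\<^esub>}" "g -` carrier K \<inter> ?N = ?N"
    using ker by (auto simp: kernel_def)
  ultimately have low: "(cyclic_step G)\<^sup>*\<^sup>* {\<one>\<^bsub>G\<^esub>} ?N" by simp
  have "(cyclic_step G)\<^sup>*\<^sup>* (f -` {\<one>\<^bsub>H\<^esub>} \<inter> carrier G) (f -` carrier H \<inter> carrier G)"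
    using ss(1) f.H.supersoluble_iff_cyclic_steps
    by (intro f.cyclic_steps_vimage_Int f.G.normal_self) blast
  moreover have "f -` {\<one>\<^bsub>H\<^esub>} \<inter> carrier G = ?N" "f -` carrier H \<inter> carrier G = carrier G"
    by (auto simp: kernel_def)
  ultimately have "(cyclic_step G)\<^sup>*\<^sup>* ?N (carrier G)" by simp
  with low show ?thesis
    using f.G.supersoluble_iff_cyclic_steps rtranclp_trans[of "cyclic_step G"] by blast
qed

text \<open>The least common multiple of the two exponents annihilates a subdirect product, and a prime power
  dividing a least common multiple divides one of the two numbers.\<close>

lemma U_class_subdirect:
  assumes "group_hom G H f" "group_hom G K g"
    and ker: "kernel G H f \<inter> kernel G K g = {\<one>\<^bsub>G\<^esub>}"
    and fin: "finite (carrier G)"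
    and U: "U_class t H" "U_class t K"
  shows "U_class t G"
proof -
  interpret f: group_hom G H f by fact
  interpret g: group_hom G K g by fact
  note eH = f.H.U_class_exponentE[OF U(1)] and eK = g.H.U_class_exponentE[OF U(2)]
  let ?n = "lcm (group_exponent H) (group_exponent K)"
  have killed: "x [^]\<^bsub>G\<^esub> ?n = \<one>\<^bsub>G\<^esub>" if x: "x \<in> carrier G" for x
  proof -
    obtain k l where k: "?n = group_exponent H * k" and l: "?n = group_exponent K * l"
      by (meson dvd_def dvd_lcm1 dvd_lcm2)
    have "f (x [^]\<^bsub>G\<^esub> ?n) = (f x [^]\<^bsub>H\<^esub> group_exponent H) [^]\<^bsub>H\<^esub> k"
      using x by (simp add: f.hom_nat_pow f.H.nat_pow_pow k)
    moreover have "g (x [^]\<^bsub>G\<^esub> ?n) = (g x [^]\<^bsub>K\<^esub> group_exponent K) [^]\<^bsub>K\<^esub> l"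
      using x by (simp add: g.hom_nat_pow g.H.nat_pow_pow l)
    ultimately have "x [^]\<^bsub>G\<^esub> ?n \<in> kernel G H f \<inter> kernel G K g"
      using x eH(2)[of "f x"] eK(2)[of "g x"] by (simp add: kernel_def)
    then show ?thesis using ker by simp
  qed
  show ?thesis
  proof (rule U_classI[where n = ?n])
    show "supersoluble G"
      using supersoluble_subdirect[OF assms(1,2) ker] U unfolding U_class_def by blast
    show "power_free (t + 1) ?n" using eH eK by (intro power_free_lcm) auto
    show "?n > 0" using eH(1) eK(1) by (simp add: lcm_pos_nat)
  qed (use killed fin in auto)
qed

section \<open>The residual is contained in every normal subgroup with quotient in the class\<close>

lemma (in group) FactGroup_hom_of_subset:
  assumes "N \<lhd> G" "M \<lhd> G" "N \<subseteq> M"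
  obtains f where "group_hom (G Mod N) (G Mod M) f"
    and "\<And>x. x \<in> carrier G \<Longrightarrow> f (N #> x) = M #> x"
proof -
  interpret N: normal N G by fact
  interpret M: normal M G by fact
  have "M #> x = M #> y" if xy: "x \<in> carrier G" "y \<in> carrier G" "N #> x = N #> y" for x y
  proof -
    have "x \<in> N #> y" using rcos_self[OF xy(1) N.subgroup_axioms] xy(3) by simp
    then have "x \<in> M #> y" using assms(3) unfolding r_coset_def by blast
    then show ?thesis using repr_independence[OF _ xy(2) M.subgroup_axioms] by metis
  qed
  then obtain f where "f \<in> hom (G Mod N) (G Mod M)"
    and eq: "\<And>x. x \<in> carrier G \<Longrightarrow> f (N #> x) = M #> x"
    using FactGroup_universal[OF M.r_coset_hom_Mod assms(1)] by metis
  then have "group_hom (G Mod N) (G Mod M) f"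
    using N.factorgroup_is_group M.factorgroup_is_group
    by (simp add: group_hom_def group_hom_axioms_def)
  with eq show thesis using that by blast
qed

text \<open>The natural maps onto \<open>G Mod M\<close> and \<open>G Mod N\<close> have kernels that meet trivially, so they make the
  quotient a subdirect product.\<close>

lemma (in group) U_class_Mod_Int:
  assumes fin: "finite (carrier G)" and M: "M \<lhd> G" "U_class t (G Mod M)"
    and N: "N \<lhd> G" "U_class t (G Mod N)"
  shows "U_class t (G Mod (M \<inter> N))"
proof -
  interpret M: normal M G by fact
  interpret N: normal N G by fact
  have MN: "M \<inter> N \<lhd> G" using M N by (intro normal_subgroup_intersect)
  interpret MN: normal "M \<inter> N" G by fact
  obtain f where f: "group_hom (G Mod (M \<inter> N)) (G Mod M) f"
    "\<And>x. x \<in> carrier G \<Longrightarrow> f ((M \<inter> N) #> x) = M #> x"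
    using FactGroup_hom_of_subset[OF MN M(1)] by blast
  obtain g where g: "group_hom (G Mod (M \<inter> N)) (G Mod N) g"
    "\<And>x. x \<in> carrier G \<Longrightarrow> g ((M \<inter> N) #> x) = N #> x"
    using FactGroup_hom_of_subset[OF MN N(1)] by blast
  interpret f: group_hom "G Mod (M \<inter> N)" "G Mod M" f by fact
  interpret g: group_hom "G Mod (M \<inter> N)" "G Mod N" g by fact
  have "kernel (G Mod (M \<inter> N)) (G Mod M) f \<inter> kernel (G Mod (M \<inter> N)) (G Mod N) g
        = {\<one>\<^bsub>G Mod (M \<inter> N)\<^esub>}" (is "?L = ?R")
  proof
    show "?L \<subseteq> ?R"
    proof
      fix X assume X: "X \<in> ?L"
      then obtain x where x: "x \<in> carrier G" "X = (M \<inter> N) #> x"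
        by (auto simp: kernel_def carrier_FactGroup)
      then have "M #> x = M" "N #> x = N"
        using X f(2) g(2) by (auto simp: kernel_def)
      then have "x \<in> M \<inter> N"
        using rcos_self[OF x(1) M.subgroup_axioms] rcos_self[OF x(1) N.subgroup_axioms] by blast
      then show "X \<in> ?R" using x MN.rcos_const[OF is_group] by simp
    qed
    show "?R \<subseteq> ?L"
      using f.one_closed f.hom_one g.hom_one unfolding kernel_def by blast
  qed
  moreover have "finite (carrier (G Mod (M \<inter> N)))"
    using fin by (simp add: carrier_FactGroup)
  ultimately show ?thesis using U_class_subdirect[OF f(1) g(1)] M(2) N(2) by blast
qed

text \<open>The definition of the residual presupposes a least element. A normal subgroup of minimal order
  with quotient in the class is one, because the family of these subgroups is closed under
  intersection.\<close>

lemma (in group) residual_U_class_subset: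
  assumes fin: "finite (carrier G)" and N: "N \<lhd> G" "U_class t (G Mod N)"
  shows "residual (U_class t) G \<subseteq> N"
proof -
  let ?P = "\<lambda>N. N \<lhd> G \<and> U_class t (G Mod N)"
  obtain R where R: "?P R" and minimal: "\<And>M. ?P M \<Longrightarrow> card R \<le> card M"
    using ex_has_least_nat[of ?P N card] N by blast
  have le: "R \<subseteq> M" if M: "?P M" for M
  proof -
    have finR: "finite R"
      using R fin normal_imp_subgroup subgroup.subset finite_subset by metis
    have "?P (R \<inter> M)"
      using R M fin by (blast intro: U_class_Mod_Int normal_subgroup_intersect)
    then have "R \<inter> M = R" using minimal finR by (intro card_seteq) auto
    then show ?thesis by blast
  qed
  have "residual (U_class t) G = R"
    unfolding residual_def by (rule Least_equality) (use R le in auto)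
  then show ?thesis using le N by blast
qed

section \<open>Self-centralizing normal subgroups of prime order\<close>

lemma mult_of_residue_ring_prime:
  assumes "prime (p :: nat)"
  shows "group (mult_of (residue_ring (int p)))"
    and "cyclic_group (mult_of (residue_ring (int p)))"
    and "\<And>a. a \<in> carrier (mult_of (residue_ring (int p))) \<Longrightarrow>
           a [^]\<^bsub>mult_of (residue_ring (int p))\<^esub> (p - 1) = \<one>\<^bsub>mult_of (residue_ring (int p))\<^esub>"
proof -
  interpret R: residues_prime p "residue_ring (int p)"
    by unfold_locales (use assms in auto)
  let ?R = "residue_ring (int p)"
  show grp: "group (mult_of ?R)" by (rule R.field_mult_group)
  interpret M: group "mult_of ?R" by (rule grp)
  obtain a where a: "a \<in> carrier (mult_of ?R)"
    "carrier (mult_of ?R) = {a [^]\<^bsub>?R\<^esub> i | i::nat. i \<in> UNIV}"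
    using R.finite_field_mult_group_has_gen R.finite by blast
  have "carrier (mult_of ?R) = range (\<lambda>n::int. a [^]\<^bsub>mult_of ?R\<^esub> n)" (is "_ = ?S")
  proof
    show "?S \<subseteq> carrier (mult_of ?R)" using a(1) M.int_pow_closed by blast
    show "carrier (mult_of ?R) \<subseteq> ?S"
    proof
      fix x assume "x \<in> carrier (mult_of ?R)"
      then obtain i :: nat where "x = a [^]\<^bsub>?R\<^esub> i" using a(2) by blast
      then have "x = a [^]\<^bsub>mult_of ?R\<^esub> int i"
        by (simp add: int_pow_int nat_pow_mult_of)
      then show "x \<in> ?S" by blast
    qed
  qed
  then show "cyclic_group (mult_of ?R)" using a(1) M.cyclic_group by blast
  have "order (mult_of ?R) = p - 1"
    using R.order_mult_of R.finite by (simp add: order_def R.res_carrier_eq)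
  then show "a [^]\<^bsub>mult_of ?R\<^esub> (p - 1) = \<one>\<^bsub>mult_of ?R\<^esub>" if "a \<in> carrier (mult_of ?R)" for a
    using M.pow_order_eq_1[OF that] by simp
qed

text \<open>An automorphism of a group of prime order \<open>p\<close> with generator \<open>g\<close> is a power map \<open>g \<mapsto> g\<^sup>a\<close>, so
  conjugation on a normal subgroup of order \<open>p\<close> is a homomorphism into the units modulo \<open>p\<close>, and
  its kernel is the centralizer.\<close>

lemma (in group) conjugation_on_prime_order:
  assumes P: "P \<lhd> G" and card: "card P = p" "prime p"
  obtains \<phi> where "group_hom G (mult_of (residue_ring (int p))) \<phi>"
    and "\<And>x. x \<in> carrier G \<Longrightarrow>
           \<phi> x = \<one>\<^bsub>mult_of (residue_ring (int p))\<^esub> \<longleftrightarrow> (\<forall>h\<in>P. x \<otimes> h = h \<otimes> x)"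
proof -
  interpret P: normal P G by fact
  interpret R: residues_prime p "residue_ring (int p)"
    by unfold_locales (use card in auto)
  have "P \<noteq> {\<one>}" using card by auto
  then obtain g where g: "g \<in> P" "g \<noteq> \<one>" using P.one_closed by blast
  have gG: "g \<in> carrier G" using g(1) by simp
  note ord = prime_order_subgroup_powers(1)[OF P.subgroup_axioms card g]
  note powers = prime_order_subgroup_powers(2)[OF P.subgroup_axioms card g]
  have conj_pow: "x \<otimes> h [^] n \<otimes> inv x = (x \<otimes> h \<otimes> inv x) [^] n"
    if x: "x \<in> carrier G" and h: "h \<in> carrier G" for x h and n :: int
  proof -
    have hom: "(\<lambda>h. x \<otimes> h \<otimes> inv x) \<in> hom G G"
      using x by (auto simp: hom_def m_assoc inv_solve_left)
    show ?thesis by (rule hom_int_pow[OF hom h is_group is_group])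
  qed
  define \<phi> where "\<phi> x = (SOME i. i \<in> {0..<int p} \<and> x \<otimes> g \<otimes> inv x = g [^] i)" for x
  have \<phi>: "\<phi> x \<in> {0..<int p}" "x \<otimes> g \<otimes> inv x = g [^] \<phi> x" if x: "x \<in> carrier G" for x
  proof -
    have "\<exists>i. i \<in> {0..<int p} \<and> x \<otimes> g \<otimes> inv x = g [^] i"
      using P.inv_op_closed2[OF x g(1)] powers by blast
    from someI_ex[OF this] show "\<phi> x \<in> {0..<int p}" "x \<otimes> g \<otimes> inv x = g [^] \<phi> x"
      unfolding \<phi>_def by blast+
  qed
  have unique: "i mod int p = j mod int p" if "g [^] i = g [^] j" for i j :: int
    using that int_pow_eq[OF gG] ord by (simp add: mod_eq_dvd_iff dvd_diff_commute)
  have nonzero: "\<phi> x \<noteq> 0" if x: "x \<in> carrier G" for x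
  proof
    assume "\<phi> x = 0"
    then have "x \<otimes> g \<otimes> inv x = \<one>" using \<phi>(2)[OF x] by simp
    then have "x \<otimes> g = x" using x gG by (metis inv_equality inv_inv m_closed inv_closed)
    then show False using x gG g(2) by simp
  qed
  have mult: "\<phi> (x \<otimes> y) = (\<phi> x * \<phi> y) mod int p"
    if x: "x \<in> carrier G" and y: "y \<in> carrier G" for x y
  proof -
    have "g [^] \<phi> (x \<otimes> y) = (x \<otimes> y) \<otimes> g \<otimes> inv (x \<otimes> y)"
      using \<phi>(2)[of "x \<otimes> y"] x y by simp
    also have "\<dots> = x \<otimes> (y \<otimes> g \<otimes> inv y) \<otimes> inv x"
      using x y gG by (simp add: inv_mult_group m_assoc)
    also have "\<dots> = x \<otimes> g [^] \<phi> y \<otimes> inv x" by (simp only: \<phi>(2)[OF y])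
    also have "\<dots> = (x \<otimes> g \<otimes> inv x) [^] \<phi> y" by (rule conj_pow[OF x gG])
    also have "\<dots> = g [^] (\<phi> x * \<phi> y)" by (simp only: \<phi>(2)[OF x] int_pow_pow[OF gG])
    finally have "\<phi> (x \<otimes> y) mod int p = (\<phi> x * \<phi> y) mod int p" by (rule unique)
    then show ?thesis using \<phi>(1)[of "x \<otimes> y"] x y by simp
  qed
  show thesis
  proof
    show "group_hom G (mult_of (residue_ring (int p))) \<phi>"
      using mult_of_residue_ring_prime(1)[OF card(2)] \<phi>(1) nonzero mult
      by (auto simp: group_hom_def group_hom_axioms_def hom_def R.res_carrier_eq R.res_mult_eq
          R.res_zero_eq is_group)
    fix x assume x: "x \<in> carrier G"
    have "\<phi> x = 1 \<longleftrightarrow> (\<forall>h\<in>P. x \<otimes> h = h \<otimes> x)"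
    proof
      assume "\<phi> x = 1"
      then have fix_g: "x \<otimes> g \<otimes> inv x = g" using \<phi>(2)[OF x] gG by simp
      show "\<forall>h\<in>P. x \<otimes> h = h \<otimes> x"
      proof
        fix h assume h: "h \<in> P"
        then obtain n :: int where n: "h = g [^] n" using powers by blast
        then have "x \<otimes> h \<otimes> inv x = h" using conj_pow[OF x gG, of n] fix_g by simp
        then show "x \<otimes> h = h \<otimes> x" using x h by (metis P.mem_carrier inv_solve_right m_closed)
      qed
    next
      assume "\<forall>h\<in>P. x \<otimes> h = h \<otimes> x"
      then have "x \<otimes> g \<otimes> inv x = g" using g(1) gG x by (simp add: m_assoc)
      then have "g [^] \<phi> x = g [^] (1 :: int)" using \<phi>(2)[OF x] gG by simp
      then have "\<phi> x mod int p = 1 mod int p" by (rule unique)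
      then show "\<phi> x = 1" using \<phi>(1)[OF x] prime_gt_1_nat[OF card(2)] by simp
    qed
    then show "\<phi> x = \<one>\<^bsub>mult_of (residue_ring (int p))\<^esub> \<longleftrightarrow> (\<forall>h\<in>P. x \<otimes> h = h \<otimes> x)"
      by (simp add: R.res_one_eq)
  qed
qed

text \<open>Conjugation on \<open>P\<close> embeds \<open>G Mod P\<close> into the cyclic group of units modulo \<open>p\<close>. This gives the
  series \<open>1, P, G\<close> with cyclic factors. As \<open>x [^] (p - 1)\<close> acts trivially it lies in \<open>P\<close>, hence \<open>p * (p - 1)\<close>
  annihilates \<open>G\<close>.\<close>

lemma (in group) U_class_self_centralizing:
  assumes fin: "finite (carrier G)" and P: "P \<lhd> G" and card: "card P = p" "prime p"
    and self_centralizing: "\<And>x. x \<in> carrier G \<Longrightarrow> \<forall>h\<in>P. x \<otimes> h = h \<otimes> x \<Longrightarrow> x \<in> P"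
    and t: "t \<ge> 1" and pf: "power_free (t + 1) (p - 1)"
  shows "U_class t G"
proof -
  interpret P: normal P G by fact
  interpret GP: group "G\<lparr>carrier := P\<rparr>" using P.subgroup_axioms by (rule subgroup_imp_group)
  let ?A = "mult_of (residue_ring (int p))"
  obtain \<phi> where hom: "group_hom G ?A \<phi>"
    and one_iff: "\<And>x. x \<in> carrier G \<Longrightarrow> \<phi> x = \<one>\<^bsub>?A\<^esub> \<longleftrightarrow> (\<forall>h\<in>P. x \<otimes> h = h \<otimes> x)"
    using conjugation_on_prime_order[OF P card] by blast
  interpret \<phi>: group_hom G ?A \<phi> by fact
  have cyc: "cyclic_group (G\<lparr>carrier := P\<rparr>)"
    using cyclic_prime_order_subgroup P.subgroup_axioms card by blast
  have comm: "x \<otimes> h = h \<otimes> x" if "x \<in> P" "h \<in> P" for x h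
    using comm_groupE(4)[OF GP.cyclic_imp_abelian_group[OF cyc], of x h] that by simp
  have ker: "kernel G ?A \<phi> = P"
  proof
    show "kernel G ?A \<phi> \<subseteq> P"
    proof
      fix x assume "x \<in> kernel G ?A \<phi>"
      then have "x \<in> carrier G" "\<phi> x = \<one>\<^bsub>?A\<^esub>" by (simp_all add: kernel_def)
      then show "x \<in> P" using one_iff self_centralizing by blast
    qed
    show "P \<subseteq> kernel G ?A \<phi>"
    proof
      fix x assume x: "x \<in> P"
      then have "\<forall>h\<in>P. x \<otimes> h = h \<otimes> x" using comm by simp
      then show "x \<in> kernel G ?A \<phi>"
        using one_iff[OF P.mem_carrier[OF x]] P.mem_carrier[OF x] by (simp add: kernel_def)
    qed
  qed
  have "cyclic_group (G Mod P)"
    using \<phi>.cyclic_factor_kernel mult_of_residue_ring_prime(2)[OF card(2)] ker by simp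
  then have upper: "cyclic_step G P (carrier G)"
    using P normal_self P.subset unfolding cyclic_step_def by simp
  have "cyclic_group ((G\<lparr>carrier := P\<rparr>) Mod {\<one>})"
    using GP.cyclic_Mod_one[OF cyc] by simp
  then have lower: "cyclic_step G {\<one>} P"
    using P one_is_normal unfolding cyclic_step_def by simp
  from lower upper have ss: "supersoluble G"
    unfolding supersoluble_iff_cyclic_steps
    by (meson converse_rtranclp_into_rtranclp r_into_rtranclp)
  have killed: "x [^] (p * (p - 1)) = \<one>" if x: "x \<in> carrier G" for x
  proof -
    have "\<phi> (x [^] (p - 1)) = \<one>\<^bsub>?A\<^esub>"
      using x mult_of_residue_ring_prime(3)[OF card(2) \<phi>.hom_closed[OF x]]
      by (simp add: \<phi>.hom_nat_pow)
    then have inP: "x [^] (p - 1) \<in> P" using x ker unfolding kernel_def by auto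
    have "(x [^] (p - 1)) [^] p = \<one>"
      using GP.pow_order_eq_1[of "x [^] (p - 1)"] inP card
        nat_pow_consistent[of "x [^] (p - 1)" p P] by (simp add: order_def)
    then show ?thesis using x by (simp add: nat_pow_pow mult.commute)
  qed
  show ?thesis
  proof (rule U_classI[where n = "p * (p - 1)"])
    show "p * (p - 1) > 0" using prime_gt_1_nat[OF card(2)] by simp
    show "power_free (t + 1) (p * (p - 1))"
      using power_free_prime_times_pred card(2) t pf by simp
  qed (use fin ss killed is_group in auto)
qed

section \<open>Subgroups of prime index in soluble groups\<close>

lemma (in group) subgroup_above_prime_index:
  assumes fin: "finite (carrier G)" and M: "subgroup M G" and p: "prime (card (rcosets M))"
    and X: "subgroup X G" "M \<subseteq> X"
  shows "X = M \<or> X = carrier G"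
proof -
  let ?k = "card (rcosets\<^bsub>G\<lparr>carrier := X\<rparr>\<^esub> M)"
  have finX: "finite X" and XG: "X \<subseteq> carrier G"
    using X fin subgroup.subset finite_subset by metis+
  have Mpos: "card M > 0"
    using finX X(2) subgroup.one_closed[OF M] finite_subset by (metis card_gt_0_iff empty_iff)
  have X_M: "?k * card M = card X"
    using group.lagrange[OF subgroup_imp_group[OF X(1)] subgroup_incl[OF M X]]
    by (simp add: order_def)
  have "card (rcosets M) * card M = card (rcosets X) * (?k * card M)"
    using lagrange[OF M] lagrange[OF X(1)] X_M by simp
  then have "card (rcosets M) = card (rcosets X) * ?k" using Mpos by simp
  then have "card (rcosets X) = 1 \<or> ?k = 1"
    using p by (metis prime_product)
  then show ?thesis
  proof
    assume "card (rcosets X) = 1"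
    then have "card X = card (carrier G)" using lagrange[OF X(1)] by (simp add: order_def)
    then show ?thesis using card_subset_eq[OF fin XG] by blast
  next
    assume "?k = 1"
    then have "card M = card X" using X_M by simp
    then show ?thesis using card_subset_eq[OF finX X(2)] by blast
  qed
qed

text \<open>The last non-trivial term of the derived series is abelian, because its commutators lie in the next term.\<close>

lemma (in group) solvable_imp_abelian_normal:
  assumes "solvable G" "carrier G \<noteq> {\<one>}"
  obtains L where "L \<lhd> G" "L \<noteq> {\<one>}" "\<And>x y. x \<in> L \<Longrightarrow> y \<in> L \<Longrightarrow> x \<otimes> y = y \<otimes> x"
proof -
  let ?D = "\<lambda>n. (derived G ^^ n) (carrier G)"
  have normal: "?D n \<lhd> G" for n
    by (induct n) (auto intro: derived_is_normal normal_self)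
  define n where "n = (LEAST n. ?D n = {\<one>})"
  have "\<exists>n. ?D n = {\<one>}" using assms(1) solvable_iff_trivial_derived_seq by blast
  then have Dn: "?D n = {\<one>}" unfolding n_def by (rule LeastI_ex)
  have "n \<noteq> 0" using Dn assms(2) by (metis funpow_0)
  then obtain m where m: "n = Suc m" by (metis not0_implies_Suc)
  have nontriv: "?D m \<noteq> {\<one>}" using not_less_Least[of m "\<lambda>n. ?D n = {\<one>}"] m n_def by simp
  have triv: "derived G (?D m) = {\<one>}" using Dn m by simp
  have "x \<otimes> y = y \<otimes> x" if xy: "x \<in> ?D m" "y \<in> ?D m" for x y
  proof -
    have car: "x \<in> carrier G" "y \<in> carrier G"
      using xy normal[of m] by (meson normal_imp_subgroup subgroup.mem_carrier)+
    have "x \<otimes> y \<otimes> inv x \<otimes> inv y \<in> derived G (?D m)"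
      unfolding derived_def[of G "?D m"]
      by (rule generate.incl, rule UN_I[OF xy(1)], rule UN_I[OF xy(2)], rule singletonI)
    then have "x \<otimes> y \<otimes> inv x \<otimes> inv y = \<one>" using triv by blast
    then have "x \<otimes> y \<otimes> inv (y \<otimes> x) = \<one>" using car by (simp add: inv_mult_group m_assoc)
    then show ?thesis
      using inv_solve_right[of \<one> "x \<otimes> y" "y \<otimes> x"] car by simp
  qed
  then show thesis using that[OF normal nontriv] by blast
qed

text \<open>Let \<open>L\<close> be a non-trivial abelian normal subgroup. It is not contained in \<open>M\<close>, so \<open>G = LM\<close> by
  maximality of \<open>M\<close>. A subgroup of \<open>M\<close> that is normalized by \<open>M\<close> and by \<open>L\<close> is then normal in \<open>G\<close>, hence
  trivial. This applies to \<open>L \<inter> M\<close>, which makes \<open>L\<close> a transversal of \<open>M\<close> and gives it order \<open>p\<close>, and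
  to the intersection of \<open>M\<close> with the centralizer of \<open>L\<close>, which shows that \<open>L\<close> is its own
  centralizer.\<close>

lemma (in group) U_class_core_free:
  assumes fin: "finite (carrier G)" and solv: "solvable G"
    and M: "subgroup M G" and index: "card (rcosets M) = p" "prime p"
    and core_free: "\<And>X. X \<lhd> G \<Longrightarrow> X \<subseteq> M \<Longrightarrow> X = {\<one>}"
    and t: "t \<ge> 1" and pf: "power_free (t + 1) (p - 1)"
  shows "U_class t G"
proof -
  have "carrier G \<noteq> {\<one>}"
  proof
    assume "carrier G = {\<one>}"
    then have "p * card M = 1" using lagrange[OF M] index(1) by (simp add: order_def)
    then show False using index(2) by simp
  qed
  then obtain L where L: "L \<lhd> G" and nontriv: "L \<noteq> {\<one>}"
    and comm: "\<And>x y. x \<in> L \<Longrightarrow> y \<in> L \<Longrightarrow> x \<otimes> y = y \<otimes> x"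
    using solvable_imp_abelian_normal[OF solv] by blast
  interpret L: normal L G by fact
  interpret M: subgroup M G by fact
  have sub: "subgroup (L <#> M) G" using L M by (rule mult_norm_subgroup)
  have MLM: "M \<subseteq> L <#> M"
  proof
    fix x assume x: "x \<in> M"
    then have "\<one> \<otimes> x \<in> L <#> M" using L.one_closed unfolding set_mult_def by blast
    then show "x \<in> L <#> M" using x by simp
  qed
  have LLM: "L \<subseteq> L <#> M"
  proof
    fix x assume x: "x \<in> L"
    then have "x \<otimes> \<one> \<in> L <#> M" using M.one_closed unfolding set_mult_def by blast
    then show "x \<in> L <#> M" using x by simp
  qed
  have "L <#> M \<noteq> M" using LLM core_free[OF L] nontriv by blast
  then have "L <#> M = carrier G"
    using subgroup_above_prime_index[OF fin M _ sub MLM] index by blast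
  then have decomp: "\<exists>l\<in>L. \<exists>m\<in>M. x = l \<otimes> m" if "x \<in> carrier G" for x
  proof -
    have "x \<in> L <#> M" using that \<open>L <#> M = carrier G\<close> by simp
    then show ?thesis unfolding set_mult_def by blast
  qed
  have normal_if_invariant: "X \<lhd> G"
    if X: "subgroup X G" and l: "\<And>l x. l \<in> L \<Longrightarrow> x \<in> X \<Longrightarrow> l \<otimes> x \<otimes> inv l \<in> X"
      and m: "\<And>m x. m \<in> M \<Longrightarrow> x \<in> X \<Longrightarrow> m \<otimes> x \<otimes> inv m \<in> X" for X
  proof (rule normal_invI[OF X])
    fix g x assume g: "g \<in> carrier G" and x: "x \<in> X"
    obtain k n where kn: "k \<in> L" "n \<in> M" "g = k \<otimes> n" using decomp[OF g] by blast
    have "g \<otimes> x \<otimes> inv g = k \<otimes> (n \<otimes> x \<otimes> inv n) \<otimes> inv k"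
      using kn subgroup.mem_carrier[OF X x] by (simp add: inv_mult_group m_assoc)
    then show "g \<otimes> x \<otimes> inv g \<in> X" using l m kn x by simp
  qed
  have "L \<inter> M \<lhd> G"
  proof (rule normal_if_invariant)
    show "subgroup (L \<inter> M) G"
      using L.subgroup_axioms M by (rule subgroups_Inter_pair)
    show "l \<otimes> x \<otimes> inv l \<in> L \<inter> M" if "l \<in> L" "x \<in> L \<inter> M" for l x
      using that comm[of l x] by (simp add: m_assoc)
    show "m \<otimes> x \<otimes> inv m \<in> L \<inter> M" if "m \<in> M" "x \<in> L \<inter> M" for m x
      using that L.inv_op_closed2[of m x] by simp
  qed
  then have LM: "L \<inter> M = {\<one>}" using core_free by blast
  have "bij_betw (\<lambda>l. M #> l) L (rcosets M)"
  proof (rule bij_betw_imageI)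
    show "inj_on (\<lambda>l. M #> l) L"
    proof (rule inj_onI)
      fix k l assume kl: "k \<in> L" "l \<in> L" and eq: "M #> k = M #> l"
      then have "k \<in> M #> l" using rcos_self[of k M] M by auto
      then obtain m where m: "m \<in> M" "k = m \<otimes> l" unfolding r_coset_def by blast
      then have "m = k \<otimes> inv l" using kl inv_solve_right[of m k l] by simp
      then have "m \<in> L \<inter> M" using kl m(1) L.m_closed L.m_inv_closed by (metis IntI)
      then show "k = l" using LM m kl by simp
    qed
    show "(\<lambda>l. M #> l) ` L = rcosets M"
    proof
      show "(\<lambda>l. M #> l) ` L \<subseteq> rcosets M" by (auto intro: rcosetsI M.subset)
      show "rcosets M \<subseteq> (\<lambda>l. M #> l) ` L"
      proof
        fix c assume "c \<in> rcosets M"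
        then obtain x where x: "x \<in> carrier G" "c = M #> x" by (auto simp: RCOSETS_def)
        obtain l m where lm: "l \<in> L" "m \<in> M" "inv x = l \<otimes> m" using decomp[of "inv x"] x by auto
        then have "x = inv m \<otimes> inv l" using x by (metis L.mem_carrier M.mem_carrier inv_inv inv_mult_group)
        then have "c = M #> inv m #> inv l"
          using x lm by (simp add: coset_mult_assoc M.subset)
        also have "M #> inv m = M" using M.rcos_const[OF is_group] lm by simp
        finally show "c \<in> (\<lambda>l. M #> l) ` L" using lm by blast
      qed
    qed
  qed
  then have card: "card L = p" using index(1) bij_betw_same_card by blast
  let ?A = "mult_of (residue_ring (int p))"
  obtain \<phi> where hom: "group_hom G ?A \<phi>"
    and one_iff: "\<And>x. x \<in> carrier G \<Longrightarrow> \<phi> x = \<one>\<^bsub>?A\<^esub> \<longleftrightarrow> (\<forall>h\<in>L. x \<otimes> h = h \<otimes> x)"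
    using conjugation_on_prime_order[OF L card index(2)] by blast
  define C where "C = kernel G ?A \<phi>"
  have C_iff: "x \<in> C \<longleftrightarrow> x \<in> carrier G \<and> (\<forall>h\<in>L. x \<otimes> h = h \<otimes> x)" for x
    using one_iff[of x] unfolding C_def kernel_def by blast
  interpret C: normal C G unfolding C_def by (rule group_hom.normal_kernel[OF hom])
  have "C \<inter> M \<lhd> G"
  proof (rule normal_if_invariant)
    show "subgroup (C \<inter> M) G"
      using C.subgroup_axioms M by (rule subgroups_Inter_pair)
    show "l \<otimes> x \<otimes> inv l \<in> C \<inter> M" if l: "l \<in> L" and x: "x \<in> C \<inter> M" for l x
    proof -
      have "l \<otimes> x = x \<otimes> l" using C_iff[of x] l x by simp
      then have "l \<otimes> x \<otimes> inv l = x" using l x by (simp add: m_assoc)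
      then show ?thesis using x by simp
    qed
    show "m \<otimes> x \<otimes> inv m \<in> C \<inter> M" if "m \<in> M" "x \<in> C \<inter> M" for m x
      using that C.inv_op_closed2[of m x] by simp
  qed
  then have CM: "C \<inter> M = {\<one>}" using core_free by blast
  show ?thesis
  proof (rule U_class_self_centralizing[OF fin L card index(2) _ t pf])
    fix x assume x: "x \<in> carrier G" "\<forall>h\<in>L. x \<otimes> h = h \<otimes> x"
    then have xC: "x \<in> C" using C_iff by blast
    obtain l m where lm: "l \<in> L" "m \<in> M" "x = l \<otimes> m" using decomp[OF x(1)] by blast
    have "l \<in> C" using C_iff[of l] lm(1) comm by simp
    moreover have "m = inv l \<otimes> x" using lm by (simp add: m_assoc[symmetric])
    ultimately have "m \<in> C \<inter> M" using xC lm(2) by simp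
    then show "x \<in> L" using CM lm by simp
  qed
qed

text \<open>Factoring out the largest normal subgroup contained in \<open>M\<close> makes \<open>M\<close> core-free without changing
  its index.\<close>

lemma (in group) prime_index_U_class_quotient:
  assumes fin: "finite (carrier G)" and solv: "solvable G"
    and M: "subgroup M G" and index: "card (rcosets M) = p" "prime p"
    and t: "t \<ge> 1" and pf: "power_free (t + 1) (p - 1)"
  shows "\<exists>N. N \<lhd> G \<and> N \<subseteq> M \<and> U_class t (G Mod N)"
proof -
  interpret M: subgroup M G by fact
  have finM: "finite M" using fin M.subset finite_subset by blast
  \<comment> \<open>A normal subgroup of \<open>G\<close> of largest order inside \<open>M\<close> serves as the core of \<open>M\<close>.\<close>
  have "\<exists>N. (N \<lhd> G \<and> N \<subseteq> M) \<and> (\<forall>X. X \<lhd> G \<and> X \<subseteq> M \<longrightarrow> card X \<le> card N)"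
    by (rule ex_has_greatest_nat[where k = "{\<one>}" and b = "Suc (card M)"])
      (use one_is_normal finM in \<open>auto intro: card_mono le_SucI simp: less_Suc_eq_le\<close>)
  then obtain N where N: "N \<lhd> G" "N \<subseteq> M"
    and largest: "\<And>X. X \<lhd> G \<Longrightarrow> X \<subseteq> M \<Longrightarrow> card X \<le> card N" by blast
  interpret N: normal N G by fact
  let ?Q = "G Mod N" and ?\<pi> = "\<lambda>x. N #> x"
  interpret Q: group ?Q by (rule N.factorgroup_is_group)
  interpret \<pi>: group_hom G ?Q ?\<pi> by unfold_locales (rule N.r_coset_hom_Mod)
  have sub: "subgroup (?\<pi> ` M) ?Q" using M by (rule \<pi>.subgroup_img_is_subgroup)
  have finQ: "finite (carrier ?Q)" using fin by (simp add: carrier_FactGroup)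
  have "rcosets\<^bsub>G\<lparr>carrier := M\<rparr>\<^esub> N = ?\<pi> ` M" by (auto simp: RCOSETS_def)
  then have cardM: "card (?\<pi> ` M) * card N = card M"
    using group.lagrange[OF subgroup_imp_group[OF M] subgroup_incl[OF N.subgroup_axioms M N(2)]]
    by (simp add: order_def)
  have "card (carrier ?Q) * card N = order G"
    using lagrange[OF N.subgroup_axioms] by (simp add: FactGroup_def)
  then have "card (rcosets\<^bsub>?Q\<^esub> (?\<pi> ` M)) * card M = p * card M"
    using Q.lagrange[OF sub] lagrange[OF M] cardM index(1) by (metis mult.assoc order_def)
  then have indexQ: "card (rcosets\<^bsub>?Q\<^esub> (?\<pi> ` M)) = p"
  proof -
    have "card M \<noteq> 0" using finM M.one_closed card_eq_0_iff[of M] by blast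
    with \<open>_ = p * card M\<close> show ?thesis by simp
  qed
  have core_free: "X = {\<one>\<^bsub>?Q\<^esub>}" if X: "X \<lhd> ?Q" "X \<subseteq> ?\<pi> ` M" for X
  proof -
    interpret X: normal X ?Q by fact
    let ?Y = "?\<pi> -` X \<inter> carrier G"
    have Y: "?Y \<lhd> G" using X(1) normal_self by (rule \<pi>.normal_vimage_Int)
    have YM: "?Y \<subseteq> M"
    proof
      fix y assume y: "y \<in> ?Y"
      then obtain m where m: "m \<in> M" "N #> y = N #> m" using X(2) by blast
      then have "y \<in> N #> m" using y rcos_self[of y N] N.subgroup_axioms by auto
      then show "y \<in> M" using m N(2) by (auto simp: r_coset_def)
    qed
    have "N \<subseteq> ?Y" using X.one_closed N.rcos_const[OF is_group] by auto
    then have "N = ?Y"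
      using largest[OF Y YM] finM YM by (intro card_seteq) (auto intro: finite_subset)
    moreover have "X \<subseteq> ?\<pi> ` ?Y" using X.subset by (auto simp: carrier_FactGroup)
    ultimately have "X \<subseteq> ?\<pi> ` N" by metis
    then have "X \<subseteq> {N}" using N.rcos_const[OF is_group] by auto
    then show ?thesis using X.one_closed by auto
  qed
  have "solvable ?Q"
    using \<pi>.surj_hom_imp_solvable solv by (simp add: carrier_FactGroup)
  then have "U_class t ?Q"
    using Q.U_class_core_free[OF finQ _ sub indexQ index(2) core_free t pf] by blast
  then show ?thesis using N by blast
qed

section \<open>Normal subgroups of soluble groups\<close>

text \<open>A finite abelian group without proper non-trivial subgroups is generated by any \<open>g \<noteq> 1\<close>. For a
  prime \<open>q\<close> dividing the order of \<open>g\<close> the elements with \<open>q\<close>-th power \<open>1\<close> form a non-trivial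
  subgroup, so \<open>q\<close> annihilates the whole group.\<close>

lemma (in comm_group) U_class_no_proper_subgroups:
  assumes fin: "finite (carrier G)" and nontriv: "carrier G \<noteq> {\<one>}"
    and simple: "\<And>X. subgroup X G \<Longrightarrow> X \<noteq> {\<one>} \<Longrightarrow> X = carrier G"
    and t: "t \<ge> 1"
  shows "U_class t G"
proof -
  obtain g where g: "g \<in> carrier G" "g \<noteq> \<one>" using nontriv by blast
  have "subgroup (generate G {g}) G" using g(1) by (intro generate_is_subgroup) simp
  moreover have "g \<in> generate G {g}" by (rule generate.incl) simp
  ultimately have "generate G {g} = carrier G" using simple g(2) by blast
  then have gen: "carrier G = range (\<lambda>n::int. g [^] n)"
    using generate_pow[OF g(1)] by (simp add: full_SetCompr_eq)
  then have cyc: "cyclic_group G" using g(1) cyclic_group by blast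
  have "cyclic_step G {\<one>} (carrier G)"
    using cyclic_Mod_one[OF cyc] one_is_normal normal_self unfolding cyclic_step_def by simp
  then have ss: "supersoluble G" unfolding supersoluble_iff_cyclic_steps by (rule r_into_rtranclp)
  have "ord g \<noteq> 1" using g ord_eq_1 by blast
  then obtain q where q: "prime q" "q dvd ord g" using prime_factor_nat by blast
  then obtain k where k: "ord g = q * k" by blast
  have "ord g > 0" using ord_ge_1[OF fin g(1)] by simp
  then have "\<not> ord g dvd k"
    using k q(1) prime_gt_1_nat by (auto dest!: dvd_imp_le)
  then have h: "g [^] k \<noteq> \<one>" using pow_eq_id[OF g(1)] by simp
  have "(g [^] k) [^] q = \<one>" using pow_ord_eq_1[OF g(1)] k g(1) by (simp add: nat_pow_pow mult.commute)
  moreover have "subgroup {x \<in> carrier G. x [^] q = \<one>} G"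
  proof (rule subgroupI)
    show "{x \<in> carrier G. x [^] q = \<one>} \<noteq> {}" using one_closed nat_pow_one by blast
  qed (auto simp: nat_pow_distrib nat_pow_inv)
  ultimately have "{x \<in> carrier G. x [^] q = \<one>} = carrier G"
    using simple h g(1) by blast
  then have killed: "x [^] q = \<one>" if "x \<in> carrier G" for x using that by blast
  show ?thesis
    by (rule U_classI[where n = q])
      (use fin ss killed q(1) t is_group power_free_prime prime_gt_0_nat in auto)
qed

text \<open>For a maximal proper normal subgroup \<open>A\<close> above \<open>M\<close> the quotient is simple and soluble, hence
  abelian without proper non-trivial subgroups. The quotient by \<open>M\<close> itself will not do in general: it may
  have an exponent divisible by a high prime power.\<close>

lemma (in group) normal_U_class_quotient:
  assumes fin: "finite (carrier G)" and solv: "solvable G"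
    and M: "M \<lhd> G" "M \<noteq> carrier G" and t: "t \<ge> 1"
  shows "\<exists>A. A \<lhd> G \<and> M \<subseteq> A \<and> A \<noteq> carrier G \<and> U_class t (G Mod A)"
proof -
  let ?P = "\<lambda>A. A \<lhd> G \<and> M \<subseteq> A \<and> A \<noteq> carrier G"
  have card_le: "card A \<le> card (carrier G)" if "A \<lhd> G" for A
    using that fin by (meson card_mono normal_imp_subgroup subgroup.subset)
  have "\<exists>A. ?P A \<and> (\<forall>X. ?P X \<longrightarrow> card X \<le> card A)"
    by (rule ex_has_greatest_nat[where k = M and b = "Suc (card (carrier G))"])
      (use M card_le in \<open>auto simp: less_Suc_eq_le\<close>)
  then obtain A where A: "A \<lhd> G" "M \<subseteq> A" "A \<noteq> carrier G"
    and largest: "\<And>X. ?P X \<Longrightarrow> card X \<le> card A" by blast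
  interpret A: normal A G by fact
  let ?Q = "G Mod A" and ?\<pi> = "\<lambda>x. A #> x"
  interpret Q: group ?Q by (rule A.factorgroup_is_group)
  interpret \<pi>: group_hom G ?Q ?\<pi> by unfold_locales (rule A.r_coset_hom_Mod)
  have finQ: "finite (carrier ?Q)" using fin by (simp add: carrier_FactGroup)
  have surj: "?\<pi> ` carrier G = carrier ?Q" by (simp add: carrier_FactGroup)
  have nontriv: "carrier ?Q \<noteq> {\<one>\<^bsub>?Q\<^esub>}"
    using A(3) A.fact_group_trivial_iff[OF fin] by blast
  have simple: "X = carrier ?Q" if X: "X \<lhd> ?Q" "X \<noteq> {\<one>\<^bsub>?Q\<^esub>}" for X
  proof -
    interpret X: normal X ?Q by fact
    let ?Y = "?\<pi> -` X \<inter> carrier G"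
    have Y: "?Y \<lhd> G" using X(1) normal_self by (rule \<pi>.normal_vimage_Int)
    have AY: "A \<subseteq> ?Y" using X.one_closed A.rcos_const[OF is_group] by auto
    have XY: "X = ?\<pi> ` ?Y"
    proof
      show "X \<subseteq> ?\<pi> ` ?Y"
      proof
        fix Z assume Z: "Z \<in> X"
        then have "Z \<in> ?\<pi> ` carrier G" using X.subset surj by blast
        then obtain x where "x \<in> carrier G" "Z = A #> x" by blast
        then show "Z \<in> ?\<pi> ` ?Y" using Z by blast
      qed
    qed blast
    have "?Y \<noteq> A"
    proof
      assume "?Y = A"
      then have "X = ?\<pi> ` A" using XY by simp
      then have "X \<subseteq> {A}" using A.rcos_const[OF is_group] by auto
      then show False using X(2) X.one_closed by auto
    qed
    then have "card A < card ?Y"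
      using AY fin by (intro psubset_card_mono) auto
    then have "?Y = carrier G" using largest[of ?Y] Y AY A(2) by fastforce
    then show ?thesis using XY surj by simp
  qed
  have "solvable ?Q" using \<pi>.surj_hom_imp_solvable surj solv by blast
  then obtain L where L: "L \<lhd> ?Q" "L \<noteq> {\<one>\<^bsub>?Q\<^esub>}"
    and comm: "\<And>x y. x \<in> L \<Longrightarrow> y \<in> L \<Longrightarrow> x \<otimes>\<^bsub>?Q\<^esub> y = y \<otimes>\<^bsub>?Q\<^esub> x"
    using Q.solvable_imp_abelian_normal nontriv by blast
  interpret Q: comm_group ?Q
    by (rule Q.group_comm_groupI) (use comm simple[OF L] in simp)
  have "U_class t ?Q"
    using Q.U_class_no_proper_subgroups[OF finQ nontriv _ t] simple Q.normal_iff_subgroup by blast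
  then show ?thesis using A by blast
qed

section \<open>Assembling the chain\<close>

text \<open>One link of a chain that witnesses \<open>F_subnormal\<close> for the class \<open>U_class t\<close>.\<close>

definition U_subnormal_step :: "nat \<Rightarrow> ('a, 'b) monoid_scheme \<Rightarrow> 'a set \<Rightarrow> 'a set \<Rightarrow> bool" where
  "U_subnormal_step t G A B \<longleftrightarrow> subgroup A G \<and> subgroup B G \<and> A \<subseteq> B \<and>
     residual (U_class t) (G\<lparr>carrier := B\<rparr>) \<subseteq> A"

lemma (in group) solvable_carrier_update:
  assumes "solvable G" "subgroup B G"
  shows "solvable (G\<lparr>carrier := B\<rparr>)"
proof -
  have "group_hom (G\<lparr>carrier := B\<rparr>) G (\<lambda>x. x)"
    using subgroup_imp_group[OF assms(2)] subgroup.mem_carrier[OF assms(2)] is_group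
    by (simp add: group_hom_def group_hom_axioms_def hom_def Pi_iff)
  then show ?thesis using group_hom.inj_hom_imp_solvable assms(1) by fastforce
qed

lemma (in group) U_subnormal_step_prime_index:
  assumes "finite (carrier G)" "solvable G" and A: "subgroup A G" and B: "subgroup B G"
    and AB: "A \<subseteq> B"
    and index: "card (rcosets\<^bsub>G\<lparr>carrier := B\<rparr>\<^esub> A) = p" "prime p"
    and t: "t \<ge> 1" and pf: "power_free (t + 1) (p - 1)"
  shows "U_subnormal_step t G A B"
proof -
  interpret B: group "G\<lparr>carrier := B\<rparr>" using B by (rule subgroup_imp_group)
  have fin: "finite (carrier (G\<lparr>carrier := B\<rparr>))"
    using assms(1) subgroup.subset[OF B] finite_subset by auto
  obtain N where "N \<lhd> G\<lparr>carrier := B\<rparr>" "N \<subseteq> A" "U_class t (G\<lparr>carrier := B\<rparr> Mod N)"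
    using B.prime_index_U_class_quotient[OF fin solvable_carrier_update[OF assms(2) B]
        subgroup_incl[OF A B AB] index t pf] by blast
  then show ?thesis
    using B.residual_U_class_subset[OF fin] A B AB unfolding U_subnormal_step_def by blast
qed

text \<open>The induction descends from \<open>B\<close> to a maximal proper normal subgroup of \<open>B\<close> above \<open>A\<close>, in which
  \<open>A\<close> is again normal.\<close>

lemma (in group) U_subnormal_steps_normal:
  assumes "finite (carrier G)" "solvable G" and A: "subgroup A G" and t: "t \<ge> 1"
    and "subgroup B G" "A \<lhd> G\<lparr>carrier := B\<rparr>"
  shows "(U_subnormal_step t G)\<^sup>*\<^sup>* A B"
  using assms(5,6)
proof (induction "card B" arbitrary: B rule: less_induct)
  case less
  note B = less.prems(1)
  interpret B: group "G\<lparr>carrier := B\<rparr>" using B by (rule subgroup_imp_group)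
  have finB: "finite B" using assms(1) subgroup.subset[OF B] finite_subset by blast
  show ?case
  proof (cases "A = B")
    case False
    then obtain C where C: "C \<lhd> G\<lparr>carrier := B\<rparr>" "A \<subseteq> C" "C \<noteq> B"
      and U: "U_class t (G\<lparr>carrier := B\<rparr> Mod C)"
      using B.normal_U_class_quotient[OF _ solvable_carrier_update[OF assms(2) B] less.prems(2) _ t]
        finB by auto
    have subCB: "subgroup C (G\<lparr>carrier := B\<rparr>)" using C(1) by (rule normal_imp_subgroup)
    then have CB: "C \<subseteq> B" using subgroup.subset by fastforce
    have subC: "subgroup C G" using B subCB by (rule incl_subgroup)
    have "A \<lhd> G\<lparr>carrier := C\<rparr>"
      using B.normal_restrict_supergroup[OF subCB less.prems(2) C(2)] by simp
    moreover have "card C < card B" using finB CB C(3) by (intro psubset_card_mono) auto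
    ultimately have "(U_subnormal_step t G)\<^sup>*\<^sup>* A C" using less.hyps subC by blast
    moreover have "U_subnormal_step t G C B"
      using B.residual_U_class_subset[OF _ C(1) U] finB subC B CB unfolding U_subnormal_step_def by simp
    ultimately show ?thesis by (rule rtranclp.rtrancl_into_rtrancl)
  qed simp
qed

lemma F_subnormal_if_U_subnormal_steps:
  assumes "(U_subnormal_step t G)\<^sup>*\<^sup>* H (carrier G)"
  shows "F_subnormal (U_class t) H G"
proof (cases "H = carrier G")
  case False
  obtain n C where C: "C 0 = H" "C n = carrier G"
    and step: "\<forall>i<n. U_subnormal_step t G (C i) (C (Suc i))"
    using assms unfolding rtranclp_power relpowp_fun_conv by blast
  have "n \<noteq> 0" using C False by metis
  have "subgroup (C i) G" if i: "i \<le> n" for i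
  proof (cases "i = n")
    case True
    then obtain j where "i = Suc j" "j < n" using \<open>n \<noteq> 0\<close> by (metis lessI not0_implies_Suc)
    then show ?thesis using step unfolding U_subnormal_step_def by blast
  qed (use step i in \<open>auto simp: U_subnormal_step_def\<close>)
  then show ?thesis using C step unfolding F_subnormal_def U_subnormal_step_def by blast
qed (simp add: F_subnormal_def)

theorem lemma2p4:
  fixes G :: "('a, 'b) monoid_scheme" and H :: "'a set" and t :: nat
  assumes "t \<ge> 1"
    and "group G" and "finite (carrier G)" and "solvable G"
    and "subgroup H G"
    and "KP_subnormal t H G"
  shows "F_subnormal (U_class t) H G"
proof -
  interpret group G by fact
  obtain n C where C: "C 0 = H" "C n = carrier G" "\<And>i. i \<le> n \<Longrightarrow> subgroup (C i) G"
    and sub: "\<And>i. i < n \<Longrightarrow> C i \<subseteq> C (Suc i)"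
    and alt: "\<And>i. i < n \<Longrightarrow> C i \<lhd> G\<lparr>carrier := C (Suc i)\<rparr> \<or>
            (\<exists>p. prime p \<and> subgroup_index (G\<lparr>carrier := C (Suc i)\<rparr>) (C i) = p \<and>
                 power_free (t + 1) (p - 1))"
    using assms(6) unfolding KP_subnormal_def by blast
  have "(U_subnormal_step t G)\<^sup>*\<^sup>* H (C i)" if "i \<le> n" for i
    using that
  proof (induction i)
    case 0
    then show ?case using C(1) by simp
  next
    case (Suc i)
    then have subs: "subgroup (C i) G" "subgroup (C (Suc i)) G" and i: "i < n"
      using C(3) by simp_all
    have "(U_subnormal_step t G)\<^sup>*\<^sup>* (C i) (C (Suc i))"
      using alt[OF i]
    proof
      assume "C i \<lhd> G\<lparr>carrier := C (Suc i)\<rparr>"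
      then show ?thesis using U_subnormal_steps_normal assms(1,3,4) subs by blast
    next
      assume "\<exists>p. prime p \<and> subgroup_index (G\<lparr>carrier := C (Suc i)\<rparr>) (C i) = p \<and>
                power_free (t + 1) (p - 1)"
      then show ?thesis
        using U_subnormal_step_prime_index[OF assms(3,4) subs sub[OF i] _ _ assms(1)]
        unfolding subgroup_index_def by (blast intro: r_into_rtranclp)
    qed
    then show ?case using Suc by (meson Suc_leD rtranclp_trans)
  qed
  then show ?thesis using F_subnormal_if_U_subnormal_steps C(2) by fastforce
qed

end
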